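(* Let $V$ be a purely affective interaction among individuals $1,\dots,n$ with action sets $X_1,\dots,X_n$ and utility functions $V_i(x_i,u_{-i})$. Assume that each $X_i$ is an open subset of a Euclidean space, that each $V_i$ is twice continuously differentiable, and that for every $x\in X=\prod_{i=1}^n X_i$ and every $u\in\mathbb{R}^n$ the matrix $I-J_x(u)$ is a P-matrix. If $(x^*,u^* )$ is a parametric equilibrium of $V$, then $x^*$ is a Nash equilibrium of the locally induced game $U_{x^*}:\mathcal{O}_{x^*}\to\mathbb{R}^n$ of $V$ at $x^*$; that is, for every individual $i$ and every $x_i\in X_i$ with $(x_i,x^*_{-i})\in\mathcal{O}_{x^*}$, the $i$-th component $U_i$ of $U_{x^*}$ satisfies $U_i(x_i,x^*_{-i})\le U_i(x^* )$.
   Context: Purely affective interaction: individuals $i\in\{1,\dots,n\}$ have action sets $X_i$, with $X=\prod_{i=1}^n X_i$. Each individual has a utility function $V_i(x_i,u_{-i})\in\mathbb{R}$ depending only on her own action $x_i\in X_i$ and on the utility levels $u_{-i}=(u_j)_{j\ne i}\in\mathbb{R}^{n-1}$ of the others. For $x\in X$, $u\in\mathbb{R}^n$ write $V_x(u)=(V_i(x_i,u_{-i}))_{i=1}^n\in\mathbb{R}^n$. $J_x(u)$ denotes the $n\times n$ Jacobian matrix of the map $V_x:\mathbb{R}^n\to\mathbb{R}^n$ at $u$. $I$ is the identity matrix. Inequalities between vectors are componentwise. P-matrix: a square real matrix all of whose principal minors are positive. Consistent: a profile $(x,u)\in X\times\mathbb{R}^n$ is consistent if $V_x(u)=u$. Parametric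 equilibrium: a consistent profile $(x^*,u^* )$ such that $V_x(u^* )\le V_{x^*}(u^* )$ for every $x\in X$. Locally induced game at $x$: for a consistent profile $(x,u_x)$, a smooth (twice continuously differentiable) function $U_x=(U_1,\dots,U_n):\mathcal{O}_x\to\mathbb{R}^n$ on some open neighborhood $\mathcal{O}_x\subseteq X$ of $x$, with $U_x(x)=u_x$ and $V_y(U_x(y))=U_x(y)$ for all $y\in\mathcal{O}_x$. (Under the assumptions of the statement it exists by the implicit function theorem.) *)

theory Defs
  imports "HOL-Analysis.Analysis"
begin

text \<open>
  The action sets live in Euclidean spaces of possibly different dimensions. These spaces are
  rendered as linear subspaces \<open>S i\<close> of one ambient Euclidean space \<open>'a\<close> (every finite family
  of Euclidean spaces arises in this way, up to isometry), and ``\<open>X i\<close> is open'' means open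
  relative to \<open>S i\<close>. Individuals are the elements of the finite type \<open>'n\<close>.
\<close>

definition open_in_Euclidean_spaces ::
    "('n::finite \<Rightarrow> 'a::euclidean_space set) \<Rightarrow> ('n \<Rightarrow> 'a set) \<Rightarrow> bool" where
  "open_in_Euclidean_spaces S X \<longleftrightarrow>
     (\<forall>i. subspace (S i) \<and> openin (top_of_set (S i)) (X i))"

definition profiles :: "('n::finite \<Rightarrow> 'a set) \<Rightarrow> ('a ^ 'n) set" where
  "profiles X = {x. \<forall>i. x $ i \<in> X i}"

text \<open>
  The derivatives are taken within \<open>A\<close>. On a set that is relatively open in a subspace (or a
  product of subspaces), only their values along that subspace are determined, and the definition
  says that \<open>f\<close> is of class $C^2$ on \<open>A\<close> as an open subset of that subspace: a derivative given
  on the subspace can be extended to the ambient space by composition with the orthogonal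
  projection.
\<close>

definition C2_on ::
    "'a::real_normed_vector set \<Rightarrow> ('a \<Rightarrow> 'b::real_normed_vector) \<Rightarrow> bool" where
  "C2_on A f \<longleftrightarrow>
     (\<exists>(f' :: 'a \<Rightarrow> 'a \<Rightarrow>\<^sub>L 'b) (f'' :: 'a \<Rightarrow> 'a \<Rightarrow>\<^sub>L 'a \<Rightarrow>\<^sub>L 'b).
        (\<forall>x\<in>A. (f has_derivative blinfun_apply (f' x)) (at x within A)) \<and>
        (\<forall>x\<in>A. (f' has_derivative blinfun_apply (f'' x)) (at x within A)) \<and>
        continuous_on A f'')"

text \<open>
  \<open>V i\<close> takes the full vector of utility levels; that it is a function of $u_{-i}$ only is
  expressed by independence of the \<open>i\<close>-th component.
\<close>

definition purely_affective ::
    "('n::finite \<Rightarrow> 'a set) \<Rightarrow> ('n \<Rightarrow> 'a \<Rightarrow> real ^ 'n \<Rightarrow> real) \<Rightarrow> bool" where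
  "purely_affective X V \<longleftrightarrow>
     (\<forall>i. \<forall>a\<in>X i. \<forall>u v. (\<forall>j. j \<noteq> i \<longrightarrow> u $ j = v $ j) \<longrightarrow> V i a u = V i a v)"

definition smooth_interaction ::
    "('n::finite \<Rightarrow> 'a::euclidean_space set) \<Rightarrow> ('n \<Rightarrow> 'a \<Rightarrow> real ^ 'n \<Rightarrow> real) \<Rightarrow> bool" where
  "smooth_interaction X V \<longleftrightarrow> (\<forall>i. C2_on (X i \<times> UNIV) (\<lambda>(a, u). V i a u))"

definition utility_map ::
    "('n::finite \<Rightarrow> 'a \<Rightarrow> real ^ 'n \<Rightarrow> real) \<Rightarrow> 'a ^ 'n \<Rightarrow> real ^ 'n \<Rightarrow> real ^ 'n" where
  "utility_map V x u = (\<chi> i. V i (x $ i) u)"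

text \<open>
  The Leibniz formula (the library's definition of \<open>det\<close>) for the submatrix of \<open>A\<close> with rows
  and columns in \<open>K\<close>; it is stated directly because the dimension of a matrix is a type. See
  \<open>principal_minor_range\<close> below.
\<close>

definition principal_minor :: "real ^ 'n::finite ^ 'n \<Rightarrow> 'n set \<Rightarrow> real" where
  "principal_minor A K =
     (\<Sum>p | p permutes K. of_int (sign p) * (\<Prod>i\<in>K. A $ i $ p i))"

definition P_matrix :: "real ^ 'n::finite ^ 'n \<Rightarrow> bool" where
  "P_matrix A \<longleftrightarrow> (\<forall>K. K \<noteq> {} \<longrightarrow> principal_minor A K > 0)"

lemma principal_minor_range:
  fixes A :: "real ^ 'n::finite ^ 'n" and f :: "'k::finite \<Rightarrow> 'n"
  assumes f: "inj f"
  shows "principal_minor A (range f) = det (\<chi> i j. A $ f i $ f j)"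
proof -
  have bij: "bij_betw f UNIV (range f)"
    using f by (simp add: bij_betw_def)
  have perms: "bij_betw (map_permutation UNIV f) {p. p permutes UNIV} {p. p permutes range f}"
  proof -
    have "map_permutation UNIV f = (\<lambda>p x. if x \<in> range f then f (p (inv f x)) else x)"
      by (simp add: fun_eq_iff map_permutation_def restrict_id_def)
    with bij_betw_permutations[OF bij] show ?thesis by simp
  qed
  have "principal_minor A (range f) =
      (\<Sum>p | p permutes (UNIV :: 'k set). of_int (sign (map_permutation UNIV f p)) *
         (\<Prod>i\<in>range f. A $ i $ map_permutation UNIV f p i))"
    unfolding principal_minor_def
    by (rule sum.reindex_bij_betw[OF perms, symmetric])
  also have "\<dots> = (\<Sum>p | p permutes (UNIV :: 'k set). of_int (sign p) *
         (\<Prod>i\<in>UNIV. A $ f i $ f (p i)))"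
    using f by (intro sum.cong refl)
      (simp add: sign_map_permutation prod.reindex map_permutation_apply)
  finally show ?thesis
    by (simp add: det_def)
qed

definition consistent ::
    "('n::finite \<Rightarrow> 'a set) \<Rightarrow> ('n \<Rightarrow> 'a \<Rightarrow> real ^ 'n \<Rightarrow> real) \<Rightarrow> 'a ^ 'n \<Rightarrow> real ^ 'n \<Rightarrow> bool" where
  "consistent X V x u \<longleftrightarrow> x \<in> profiles X \<and> utility_map V x u = u"

text \<open>The order on \<open>real ^ 'n\<close> is the componentwise one.\<close>

definition parametric_equilibrium ::
    "('n::finite \<Rightarrow> 'a set) \<Rightarrow> ('n \<Rightarrow> 'a \<Rightarrow> real ^ 'n \<Rightarrow> real) \<Rightarrow> 'a ^ 'n \<Rightarrow> real ^ 'n \<Rightarrow> bool" where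
  "parametric_equilibrium X V x u \<longleftrightarrow>
     consistent X V x u \<and> (\<forall>y\<in>profiles X. utility_map V y u \<le> utility_map V x u)"

text \<open>\<open>U\<close>, with domain \<open>N\<close>, is a game locally induced by \<open>V\<close> at the consistent profile \<open>(x, u)\<close>.\<close>

definition locally_induced_game ::
    "('n::finite \<Rightarrow> 'a::euclidean_space set) \<Rightarrow> ('n \<Rightarrow> 'a \<Rightarrow> real ^ 'n \<Rightarrow> real) \<Rightarrow>
     'a ^ 'n \<Rightarrow> real ^ 'n \<Rightarrow> ('a ^ 'n) set \<Rightarrow> ('a ^ 'n \<Rightarrow> real ^ 'n) \<Rightarrow> bool" where
  "locally_induced_game X V x u N U \<longleftrightarrow>
     consistent X V x u \<and>
     openin (top_of_set (profiles X)) N \<and> x \<in> N \<and>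
     C2_on N U \<and> U x = u \<and> (\<forall>y\<in>N. utility_map V y (U y) = U y)"

definition deviate :: "'a ^ 'n::finite \<Rightarrow> 'n \<Rightarrow> 'a \<Rightarrow> 'a ^ 'n" where
  "deviate x i a = (\<chi> j. if j = i then a else x $ j)"

text \<open>Nash equilibrium of a game defined only on a set \<open>N\<close> of profiles.\<close>

definition Nash_equilibrium ::
    "('n::finite \<Rightarrow> 'a set) \<Rightarrow> ('a ^ 'n) set \<Rightarrow> ('a ^ 'n \<Rightarrow> real ^ 'n) \<Rightarrow> 'a ^ 'n \<Rightarrow> bool" where
  "Nash_equilibrium X N U x \<longleftrightarrow>
     x \<in> N \<and> (\<forall>i. \<forall>a\<in>X i. deviate x i a \<in> N \<longrightarrow> U (deviate x i a) $ i \<le> U x $ i)"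

end

theory Submission
  imports Defs
begin

text \<open>
  Fix a profile obtained from \<open>xs\<close> by a deviation of \<open>i\<close>, with utility map \<open>v\<close>, and put
  \<open>F u = u - v u\<close>. The Jacobian of \<open>F\<close> is a P-matrix everywhere, so \<open>F\<close> is a P-function (Gale and
  Nikaido; More and Rheinboldt): for \<open>a \<noteq> b\<close> some \<open>k\<close> has \<open>(b k - a k) * (F b k - F a k) > 0\<close>.
  Apply this to \<open>us\<close> and the new utility vector \<open>w\<close>: \<open>F w = 0\<close>, while \<open>F us\<close> vanishes off \<open>i\<close> and
  is nonnegative at \<open>i\<close>; hence \<open>w i \<le> us i\<close>.

  For the P-function property, consider the points \<open>x\<close> for which every product
  \<open>(x k - a k) * (F x k - F a k)\<close> is nonpositive. Since a P-matrix reverses the sign of no nonzero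
  vector, \<open>a\<close> is isolated among them. If another one existed, take one closest to \<open>a\<close>; by a
  theorem of the alternative it can be moved still closer to \<open>a\<close>.
\<close>

section \<open>Principal minors as full-size determinants, and P-matrices\<close>

text \<open>In the Leibniz formula a permutation that moves a point outside \<open>K\<close> picks
  up a zero from a unit row. Padding with unit rows gives all principal minors the same matrix type,
  so row linearity of \<open>det\<close> applies to them.\<close>

lemma det_rows_eq_principal_minor:
  "det (\<chi> i. if i \<in> K then A $ i else axis i 1) = principal_minor A K"
    (is "det ?M = _")
proof -
  have "det ?M = (\<Sum>p | p permutes UNIV. of_int (sign p) * (\<Prod>i\<in>UNIV. ?M $ i $ p i))"
    by (simp add: det_def)
  also have "\<dots> = (\<Sum>p | p permutes K. of_int (sign p) * (\<Prod>i\<in>UNIV. ?M $ i $ p i))"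
  proof (rule sum.mono_neutral_right)
    show "{p. p permutes K} \<subseteq> {p. p permutes UNIV}"
      by (auto intro: permutes_subset)
    show "\<forall>p\<in>{p. p permutes UNIV} - {p. p permutes K}.
        of_int (sign p) * (\<Prod>i\<in>UNIV. ?M $ i $ p i) = 0"
    proof
      fix p assume p: "p \<in> {p. p permutes UNIV} - {p. p permutes K}"
      then obtain i where i: "i \<notin> K" "p i \<noteq> i"
        unfolding permutes_def by auto
      then have "?M $ i $ p i = 0"
        by (simp add: axis_def)
      then have "(\<Prod>i\<in>UNIV. ?M $ i $ p i) = 0"
        by (intro prod_zero finite bexI[OF _ UNIV_I])
      then show "of_int (sign p) * (\<Prod>i\<in>UNIV. ?M $ i $ p i) = 0"
        by simp
    qed
  qed simp
  also have "\<dots> = principal_minor A K"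
    unfolding principal_minor_def
  proof (intro sum.cong refl)
    fix p assume p: "p \<in> {p. p permutes K}"
    have "(\<Prod>i\<in>UNIV. ?M $ i $ p i) = (\<Prod>i\<in>K. ?M $ i $ p i)"
    proof (rule prod.mono_neutral_right)
      show "\<forall>i\<in>UNIV - K. ?M $ i $ p i = 1"
        using p by (auto simp: permutes_def axis_def)
    qed auto
    then show "of_int (sign p) * (\<Prod>i\<in>UNIV. ?M $ i $ p i) =
        of_int (sign p) * (\<Prod>i\<in>K. A $ i $ p i)"
      by simp
  qed
  finally show ?thesis .
qed

lemma principal_minor_empty: "principal_minor A {} = 1"
  by (simp add: principal_minor_def)

lemma principal_minor_transpose: "principal_minor (transpose A) K = principal_minor A K"
proof -
  have "principal_minor (transpose A) K =
      (\<Sum>p | p permutes K. of_int (sign (inv p)) * (\<Prod>i\<in>K. transpose A $ i $ inv p i))"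
    unfolding principal_minor_def by (rule sum_permutations_inverse)
  also have "\<dots> = principal_minor A K"
    unfolding principal_minor_def
  proof (intro sum.cong refl)
    fix p assume "p \<in> {p. p permutes K}"
    then have p: "p permutes K" by simp
    have "(\<Prod>i\<in>K. transpose A $ i $ inv p i) = (\<Prod>i\<in>K. transpose A $ p i $ inv p (p i))"
      using prod.permute[OF p, of "\<lambda>i. transpose A $ i $ inv p i"] by (simp add: o_def)
    also have "\<dots> = (\<Prod>i\<in>K. A $ i $ p i)"
      using permutes_inverses[OF p] by (simp add: transpose_def)
    finally show "of_int (sign (inv p)) * (\<Prod>i\<in>K. transpose A $ i $ inv p i) =
        of_int (sign p) * (\<Prod>i\<in>K. A $ i $ p i)"
      by (simp only: sign_inverse[OF permutes_imp_permutation[OF finite p]])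
  qed
  finally show ?thesis .
qed

lemma P_matrix_transpose: "P_matrix A \<Longrightarrow> P_matrix (transpose A)"
  by (simp add: P_matrix_def principal_minor_transpose)

text \<open>The determinant is affine in each \<open>D t\<close>; the coefficient of
  \<open>D t\<close> is a determinant of the same form with \<open>t\<close> removed from
  \<open>K\<close>. Hence the induction on \<open>T\<close> keeps \<open>K\<close>
  arbitrary.\<close>

lemma P_matrix_det_add_diagonal_pos:
  fixes A :: "real ^ 'n::finite ^ 'n" and D :: "'n \<Rightarrow> real"
  assumes A: "P_matrix A" and D: "\<And>i. D i \<ge> 0" and T: "finite T"
  shows "det (\<chi> i. if i \<in> K then (if i \<in> T then A $ i + D i *s axis i 1 else A $ i)
                   else axis i 1) > 0"
  using T
proof (induction T arbitrary: K rule: finite_induct)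
  case empty
  then show ?case
    using A det_rows_eq_principal_minor[of K A]
    by (cases "K = {}") (auto simp: principal_minor_empty P_matrix_def cong: if_cong)
next
  case (insert t T)
  define c where "c = (\<lambda>K i. if i \<in> K then (if i \<in> T then A $ i + D i *s axis i 1 else A $ i)
                   else axis i (1::real))"
  have IH: "det (\<chi> i. c K i) > 0" for K
    using insert.IH[of K] by (simp add: c_def)
  let ?M = "\<chi> i. if i \<in> K then (if i \<in> insert t T then A $ i + D i *s axis i 1 else A $ i)
                   else axis i (1::real)"
  show ?case
  proof (cases "t \<in> K")
    case False
    then have "?M = (\<chi> i. c K i)"
      by (auto simp: c_def vec_eq_iff)
    then show ?thesis using IH[of K] by simp
  next
    case True
    have "?M = (\<chi> i. if i = t then A $ i + D i *s axis i 1 else c K i)"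
      using True by (auto simp: c_def vec_eq_iff)
    then have "det ?M = det (\<chi> i. if i = t then A $ i else c K i)
        + det (\<chi> i. if i = t then D i *s axis i 1 else c K i)"
      using det_row_add[of t "\<lambda>i. A $ i" "\<lambda>i. D i *s axis i 1" "c K"] by simp
    also have "det (\<chi> i. if i = t then D i *s axis i 1 else c K i) =
        D t * det (\<chi> i. if i = t then axis i 1 else c K i)"
    proof -
      have "(\<chi> i. if i = t then D i *s axis i 1 else c K i) =
            (\<chi> i. if i = t then D t *s axis i 1 else c K i)"
        by (simp add: vec_eq_iff)
      then show ?thesis
        using det_row_mul[of t "D t" "\<lambda>i. axis i 1" "c K"] by simp
    qed
    also have "(\<chi> i. if i = t then A $ i else c K i) = (\<chi> i. c K i)"
      using True insert.hyps by (auto simp: c_def vec_eq_iff)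
    also have "(\<chi> i. if i = t then axis i 1 else c K i) = (\<chi> i. c (K - {t}) i)"
      by (auto simp: c_def vec_eq_iff)
    finally have "det ?M = det (\<chi> i. c K i) + D t * det (\<chi> i. c (K - {t}) i)" .
    moreover have "D t * det (\<chi> i. c (K - {t}) i) \<ge> 0"
      using D IH[of "K - {t}"] by simp
    ultimately show ?thesis using IH[of K] by linarith
  qed
qed

section \<open>Sign reversal and sign preservation by P-matrices\<close>

text \<open>A nonzero \<open>x\<close> with reversed signs would be in the kernel of
  \<open>A\<close> plus a nonnegative diagonal matrix, with unit rows off the support of
  \<open>x\<close>; but that determinant is positive.\<close>

lemma P_matrix_no_sign_reversal:
  fixes A :: "real ^ 'n::finite ^ 'n"
  assumes A: "P_matrix A" and le: "\<And>k. x $ k * (A *v x) $ k \<le> 0"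
  shows "x = 0"
proof (rule ccontr)
  assume "x \<noteq> 0"
  \<comment> \<open>Chosen to give \<open>(A *v x) $ i + D i * x $ i = 0\<close> on the support of
    \<open>x\<close>.\<close>
  define D where "D i = (if x $ i = 0 then 0 else - ((A *v x) $ i / x $ i))" for i
  have D: "D i \<ge> 0" for i
    using le[of i] by (auto simp: D_def divide_le_0_iff mult_le_0_iff)
  \<comment> \<open>The vacuous test \<open>i \<in> UNIV\<close> matches the form of the determinant
    lemma with \<open>T = UNIV\<close>.\<close>
  let ?B = "\<chi> i. if i \<in> {i. x $ i \<noteq> 0}
      then (if i \<in> UNIV then A $ i + D i *s axis i 1 else A $ i) else axis i (1::real)"
  have axis: "(\<Sum>j\<in>UNIV. axis i (1::real) $ j * x $ j) = x $ i" for i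
    by (simp add: axis_def if_distrib[of "\<lambda>z. z * _"] cong: if_cong)
  have "(?B *v x) $ i = 0" for i
  proof (cases "x $ i = 0")
    case True
    then show ?thesis by (simp add: matrix_vector_mult_def axis)
  next
    case False
    then have "(?B *v x) $ i = (A *v x) $ i + D i * (\<Sum>j\<in>UNIV. axis i (1::real) $ j * x $ j)"
      by (simp add: matrix_vector_mult_def distrib_right sum.distrib sum_distrib_left mult.assoc)
    then show ?thesis using False by (simp add: axis D_def)
  qed
  then have "?B *v x = 0" by (simp add: vec_eq_iff)
  moreover have "det ?B > 0"
    by (rule P_matrix_det_add_diagonal_pos[OF A D finite])
  then have "invertible ?B"
    using invertible_det_nz[of ?B] by linarith
  then have "\<exists>C. C ** ?B = mat 1"
    unfolding invertible_def by blast
  ultimately show False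
    using \<open>x \<noteq> 0\<close> matrix_left_invertible_ker[of ?B] by blast
qed

text \<open>If no such \<open>u\<close> exists, a hyperplane separates the image of the cone
  \<open>C\<close> from the cone \<open>Q\<close>. Its normal \<open>y\<close> agrees weakly in sign
  with \<open>d\<close>, while \<open>transpose A *v y\<close> opposes \<open>d\<close>; so the
  P-matrix \<open>transpose A\<close> reverses the sign of \<open>y\<close>, which is
  impossible.\<close>

lemma P_matrix_sign_preserving_direction:
  fixes A :: "real ^ 'n::finite ^ 'n" and d :: "real ^ 'n"
  assumes A: "P_matrix A"
  obtains u where "\<And>k. d $ k = 0 \<Longrightarrow> u $ k = 0"
    and "\<And>k. d $ k \<noteq> 0 \<Longrightarrow> d $ k * u $ k \<ge> 0"
    and "\<And>k. d $ k \<noteq> 0 \<Longrightarrow> d $ k * (A *v u) $ k > 0"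
proof -
  define C where "C = {u. \<forall>k. (d $ k = 0 \<longrightarrow> u $ k = 0) \<and> d $ k * u $ k \<ge> 0}"
  define Q where "Q = {v. \<forall>k. d $ k \<noteq> 0 \<longrightarrow> d $ k * v $ k > 0}"
  have "(*v) A ` C \<inter> Q \<noteq> {}"
  proof
    assume disj: "(*v) A ` C \<inter> Q = {}"
    have "convex C"
      unfolding C_def convex_def
      by (auto simp: distrib_left mult.left_commute intro!: add_nonneg_nonneg)
    then have conv: "convex ((*v) A ` C)"
      by (intro convex_linear_image) auto
    have "convex Q"
      unfolding convex_alt Q_def
    proof (clarsimp)
      fix x y :: "real ^ 'n" and t :: real and k
      assume *: "\<forall>k. d $ k \<noteq> 0 \<longrightarrow> 0 < d $ k * x $ k" "\<forall>k. d $ k \<noteq> 0 \<longrightarrow> 0 < d $ k * y $ k"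
        "0 \<le> t" "t \<le> 1" "d $ k \<noteq> 0"
      have "(1 - t) * (d $ k * x $ k) + t * (d $ k * y $ k) > 0"
      proof (cases "t = 0")
        case False
        then have "t * (d $ k * y $ k) > 0" "(1 - t) * (d $ k * x $ k) \<ge> 0"
          using * by (auto intro: mult_pos_pos mult_nonneg_nonneg less_imp_le)
        then show ?thesis by linarith
      qed (use * in auto)
      then show "0 < d $ k * ((1 - t) * x $ k + t * y $ k)"
        by (simp add: algebra_simps)
    qed
    have d_Q: "d \<in> Q"
      by (auto simp: Q_def zero_less_mult_iff)
    have zero_C: "0 \<in> C" by (simp add: C_def)
    obtain y b where y: "y \<noteq> 0" "\<forall>v\<in>(*v) A ` C. y \<bullet> v \<le> b" "\<forall>v\<in>Q. y \<bullet> v \<ge> b"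
      using separating_hyperplane_sets[OF conv \<open>convex Q\<close>] disj d_Q zero_C by blast
    have b0: "b \<ge> 0"
      using y(2) zero_C by force
    \<comment> \<open>The ray from \<open>d\<close> in direction \<open>e\<close> stays in
      \<open>Q\<close>, where \<open>y\<close> is bounded below.\<close>
    have yd: "y \<bullet> e \<ge> 0" if e: "\<And>t k. t > 0 \<Longrightarrow> d $ k \<noteq> 0 \<Longrightarrow> d $ k * (d + t *\<^sub>R e) $ k > 0" for e
    proof (rule ccontr)
      assume neg: "\<not> y \<bullet> e \<ge> 0"
      \<comment> \<open>This makes \<open>y \<bullet> (d + t *\<^sub>R e)\<close> equal to
        -1.\<close>
      define t where "t = (y \<bullet> d + 1) / (- (y \<bullet> e))"
      have "y \<bullet> d \<ge> 0" using y(3) d_Q b0 by force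
      then have t: "t > 0" using neg unfolding t_def by (intro divide_pos_pos) auto
      have "d + t *\<^sub>R e \<in> Q" using e[OF t] by (simp add: Q_def)
      then have "y \<bullet> (d + t *\<^sub>R e) \<ge> 0" using y(3) b0 by force
      moreover have "t * (y \<bullet> e) = - (y \<bullet> d + 1)"
        using neg by (simp add: t_def field_simps)
      ultimately show False by (simp add: inner_add_right)
    qed
    \<comment> \<open>\<open>Q\<close> leaves the coordinates where \<open>d\<close> vanishes free,
      so both signs of the unit vector are admissible directions.\<close>
    have y_off: "y $ k = 0" if "d $ k = 0" for k
    proof -
      have "y \<bullet> axis k 1 \<ge> 0" "y \<bullet> (- axis k 1) \<ge> 0"
        by (rule yd; use that in \<open>auto simp: axis_def zero_less_mult_iff\<close>)+
      then show ?thesis by (simp add: inner_axis)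
    qed
    have y_on: "y $ k * d $ k \<ge> 0" for k
    proof -
      have "y \<bullet> axis k (d $ k) \<ge> 0"
      proof (rule yd)
        fix t :: real and j assume t: "t > 0" and j: "d $ j \<noteq> 0"
        have "d $ j * d $ j > 0" using j by (auto simp: zero_less_mult_iff)
        moreover have "t * (d $ j * d $ j) > 0" using t calculation by simp
        ultimately show "d $ j * (d + t *\<^sub>R axis k (d $ k)) $ j > 0"
          by (auto simp: axis_def algebra_simps)
      qed
      then show ?thesis by (simp add: inner_axis)
    qed
    have Ay: "(transpose A *v y) $ k * d $ k \<le> 0" for k
    proof (rule ccontr)
      assume pos: "\<not> ?thesis"
      \<comment> \<open>Scales a vector of the cone \<open>C\<close> until \<open>y\<close> takes
        the value \<open>b + 1\<close> on its image.\<close>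
      define t where "t = (b + 1) / ((transpose A *v y) $ k * d $ k)"
      have "t > 0" using pos b0 by (simp add: t_def divide_pos_pos)
      then have "axis k (t * d $ k) \<in> C"
        by (auto simp: C_def axis_def mult.left_commute)
      then have "y \<bullet> (A *v axis k (t * d $ k)) \<le> b" using y(2) by blast
      moreover have "y \<bullet> (A *v axis k (t * d $ k)) = (transpose A *v y) $ k * (t * d $ k)"
        by (simp add: dot_lmul_matrix[symmetric] inner_axis)
      moreover have "\<dots> = b + 1"
        using pos by (auto simp: t_def mult.left_commute)
      ultimately show False by linarith
    qed
    have "y $ k * (transpose A *v y) $ k \<le> 0" for k
    proof (cases "d $ k = 0")
      case True
      then show ?thesis using y_off by simp
    next
      case False
      then show ?thesis
        using y_on[of k] Ay[of k]
        by (auto simp: mult_le_0_iff zero_le_mult_iff)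
    qed
    then have "y = 0"
      using P_matrix_no_sign_reversal[OF P_matrix_transpose[OF A]] by blast
    then show False using y(1) by simp
  qed
  then obtain u where u: "u \<in> C" "A *v u \<in> Q" by blast
  show thesis
    using u by (intro that[of u]) (auto simp: C_def Q_def)
qed

section \<open>From the Jacobian to the P-function property\<close>

text \<open>By compactness the linear part violates sign reversal by a fixed multiple of
  \<open>(norm h)\<^sup>2\<close>, and near \<open>a\<close> the error of the linear approximation
  is too small to compensate.\<close>

lemma P_matrix_sign_reversal_isolated:
  fixes F :: "real ^ 'n::finite \<Rightarrow> real ^ 'n"
  assumes A: "P_matrix A" and F: "(F has_derivative (\<lambda>h. A *v h)) (at a)"
  obtains \<delta> where "\<delta> > 0"
    and "\<And>x. x \<noteq> a \<Longrightarrow> norm (x - a) < \<delta> \<Longrightarrow> \<exists>k. (x $ k - a $ k) * (F x $ k - F a $ k) > 0"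
proof -
  \<comment> \<open>\<open>g\<close> measures the failure of sign reversal. It is positive off 0 and
    homogeneous of degree 2, so its minimum on the unit sphere bounds it everywhere.\<close>
  define g where "g h = (\<Sum>k\<in>UNIV. max 0 (h $ k * (A *v h) $ k))" for h :: "real ^ 'n"
  have cont: "continuous_on (sphere 0 1) g"
    unfolding g_def by (intro continuous_intros matrix_vector_mult_linear_continuous_on
        linear_continuous_on) (auto intro: bounded_linear_intros)
  have "(sphere 0 1 :: (real ^ 'n) set) \<noteq> {}" by simp
  then obtain h0 where h0: "h0 \<in> sphere 0 1" "\<And>h. h \<in> sphere 0 1 \<Longrightarrow> g h0 \<le> g h"
    using continuous_attains_inf[OF compact_sphere _ cont] by blast
  define c where "c = g h0"
  have c: "c > 0"
  proof -
    have "h0 \<noteq> 0" using h0 by auto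
    then obtain k where k: "h0 $ k * (A *v h0) $ k > 0"
      using P_matrix_no_sign_reversal[OF A, of h0] by (meson not_le)
    then show ?thesis
      unfolding c_def g_def by (intro sum_pos2[of _ k]) auto
  qed
  have g_ge: "g h \<ge> c * (norm h)\<^sup>2" for h
  proof (cases "h = 0")
    case False
    define e where "e = h /\<^sub>R norm h"
    have "e \<in> sphere 0 1" using False by (simp add: e_def)
    then have "c \<le> g e" using h0 by (simp add: c_def)
    have h: "h = norm h *\<^sub>R e" using False by (simp add: e_def)
    have comp: "h $ k * (A *v h) $ k = (norm h)\<^sup>2 * (e $ k * (A *v e) $ k)" for k
    proof -
      have "h $ k = norm h * e $ k" by (subst h) simp
      moreover have "(A *v h) $ k = norm h * (A *v e) $ k"
        by (subst h) (simp add: matrix_vector_mult_scaleR)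
      ultimately show ?thesis by (simp add: power2_eq_square)
    qed
    have "max 0 ((norm h)\<^sup>2 * z) = (norm h)\<^sup>2 * max 0 z" for z
      by (simp add: max_mult_distrib_left)
    then have "g h = (norm h)\<^sup>2 * g e"
      unfolding g_def by (simp add: comp sum_distrib_left)
    then show ?thesis
      using mult_right_mono[OF \<open>c \<le> g e\<close>, of "(norm h)\<^sup>2"] by (simp add: mult.commute)
  qed (simp add: g_def)
  \<comment> \<open>With this tolerance the error terms of all coordinates add up to only half of
    \<open>c * (norm h)\<^sup>2\<close>.\<close>
  define e where "e = c / (2 * real CARD('n))"
  have e: "e > 0" using c by (simp add: e_def)
  obtain \<delta> where \<delta>: "\<delta> > 0"
    "\<And>x. norm (x - a) < \<delta> \<Longrightarrow> norm (F x - F a - A *v (x - a)) \<le> e * norm (x - a)"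
    using F e unfolding has_derivative_at_alt by blast
  show thesis
  proof (rule that[OF \<delta>(1)])
    fix x assume x: "x \<noteq> a" "norm (x - a) < \<delta>"
    show "\<exists>k. (x $ k - a $ k) * (F x $ k - F a $ k) > 0"
    proof (rule ccontr)
      assume "\<not> ?thesis"
      then have neg: "(x $ k - a $ k) * (F x $ k - F a $ k) \<le> 0" for k
        by (meson not_le)
      define h where "h = x - a"
      define r where "r = F x - F a - A *v h"
      have r: "norm r \<le> e * norm h"
        using \<delta>(2)[OF x(2)] by (simp add: r_def h_def)
      have "max 0 (h $ k * (A *v h) $ k) \<le> e * (norm h)\<^sup>2" for k
      proof -
        have "h $ k * (A *v h) $ k = h $ k * (F x $ k - F a $ k) - h $ k * r $ k"
          by (simp add: r_def algebra_simps)
        also have "\<dots> \<le> \<bar>h $ k\<bar> * \<bar>r $ k\<bar>"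
          using neg[of k] abs_ge_minus_self[of "h $ k * r $ k"]
          by (simp add: h_def abs_mult)
        also have "\<dots> \<le> norm h * (e * norm h)"
          using r component_le_norm_cart[of r k] component_le_norm_cart[of h k]
          by (intro mult_mono) auto
        finally show ?thesis using e by (simp add: power2_eq_square mult.left_commute)
      qed
      then have "g h \<le> (\<Sum>k\<in>(UNIV :: 'n set). e * (norm h)\<^sup>2)"
        unfolding g_def by (intro sum_mono)
      also have "\<dots> = c / 2 * (norm h)\<^sup>2"
        by (simp add: e_def)
      also have "\<dots> < c * (norm h)\<^sup>2"
        using c x(1) by (simp add: h_def)
      finally show False using g_ge[of h] by simp
    qed
  qed
qed

theorem P_matrix_jacobian_imp_P_function:
  fixes F :: "real ^ 'n::finite \<Rightarrow> real ^ 'n"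
  assumes F: "\<And>x. (F has_derivative (\<lambda>h. J x *v h)) (at x)"
    and J: "\<And>x. P_matrix (J x)" and "a \<noteq> b"
  shows "\<exists>k. (b $ k - a $ k) * (F b $ k - F a $ k) > 0"
proof (rule ccontr)
  assume "\<not> ?thesis"
  then have b: "(b $ k - a $ k) * (F b $ k - F a $ k) \<le> 0" for k
    by (meson not_le)
  obtain \<delta> where \<delta>: "\<delta> > 0" and
    iso: "\<And>x. x \<noteq> a \<Longrightarrow> norm (x - a) < \<delta> \<Longrightarrow> \<exists>k. (x $ k - a $ k) * (F x $ k - F a $ k) > 0"
    using P_matrix_sign_reversal_isolated[OF J F] by blast
  define R where "R = {x. \<forall>k. (x $ k - a $ k) * (F x $ k - F a $ k) \<le> 0}"
  have far: "norm (x - a) \<ge> \<delta>" if "x \<in> R" "x \<noteq> a" for x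
    using iso[OF that(2)] that(1) unfolding R_def mem_Collect_eq by (meson not_le)
  have contF: "continuous_on UNIV F"
    using F by (meson continuous_at_imp_continuous_on has_derivative_continuous)
  have R: "closed R"
    unfolding R_def by (intro closed_Collect_all closed_Collect_le continuous_intros contF)
  \<comment> \<open>The condition \<open>\<delta> \<le> norm (x - a)\<close> excludes
    \<open>a\<close> from \<open>R\<close> by a closed condition, so a closest point exists.\<close>
  have "compact (cball a (norm (b - a)) \<inter> (R \<inter> {x. \<delta> \<le> norm (x - a)}))"
    by (intro compact_Int_closed closed_Int R compact_cball closed_Collect_le continuous_intros)
  moreover have "b \<in> cball a (norm (b - a)) \<inter> (R \<inter> {x. \<delta> \<le> norm (x - a)})"
    using b far[of b] \<open>a \<noteq> b\<close> by (auto simp: R_def dist_norm norm_minus_commute)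
  moreover have "continuous_on (cball a (norm (b - a)) \<inter> (R \<inter> {x. \<delta> \<le> norm (x - a)}))
      (\<lambda>x. norm (x - a))"
    by (intro continuous_intros)
  ultimately obtain x where
    x: "x \<in> cball a (norm (b - a)) \<inter> (R \<inter> {x. \<delta> \<le> norm (x - a)})" and
    min: "\<And>z. z \<in> cball a (norm (b - a)) \<inter> (R \<inter> {x. \<delta> \<le> norm (x - a)}) \<Longrightarrow>
      norm (x - a) \<le> norm (z - a)"
    using continuous_attains_inf by (metis (no_types, lifting) empty_iff)
  define d where "d = x - a"
  have d: "d \<noteq> 0" using x \<delta> by (auto simp: d_def)
  \<comment> \<open>Moving from \<open>x\<close> along \<open>- u\<close> pulls the coordinates
    weakly towards \<open>a\<close> and strictly lowers \<open>d $ k * F x $ k\<close> to first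
    order wherever \<open>d $ k\<close> is nonzero.\<close>
  obtain u where u: "\<And>k. d $ k = 0 \<Longrightarrow> u $ k = 0" "\<And>k. d $ k \<noteq> 0 \<Longrightarrow> d $ k * u $ k \<ge> 0"
    "\<And>k. d $ k \<noteq> 0 \<Longrightarrow> d $ k * (J x *v u) $ k > 0"
    using P_matrix_sign_preserving_direction[OF J] by blast
  have u_ne: "u \<noteq> 0"
  proof
    assume "u = 0"
    obtain k where "d $ k \<noteq> 0" using d by (auto simp: vec_eq_iff)
    then show False using u(3)[of k] \<open>u = 0\<close> by simp
  qed
  have du_nonneg: "d $ k * u $ k \<ge> 0" for k
    using u(2)[of k] by (cases "d $ k = 0") auto
  have du: "d \<bullet> u > 0"
  proof -
    obtain k where k: "u $ k \<noteq> 0" using u_ne by (auto simp: vec_eq_iff)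
    then have "d $ k * u $ k > 0" using u(1)[of k] du_nonneg[of k] by (auto simp: less_le)
    then show ?thesis
      unfolding inner_vec_def using du_nonneg by (intro sum_pos2[of _ k]) auto
  qed
  have F_k: "\<forall>\<^sub>F t in at_right 0. d $ k \<noteq> 0 \<longrightarrow>
      d $ k * F (x - t *\<^sub>R u) $ k < d $ k * F x $ k" for k
  proof (cases "d $ k = 0")
    case False
    have "((\<lambda>t. F (x - t *\<^sub>R u)) has_derivative (\<lambda>t. J x *v (- (t *\<^sub>R u)))) (at 0)"
      using F[of x] by (intro has_derivative_compose[where g = F, of _ _ 0])
        (auto intro!: derivative_eq_intros)
    then have "((\<lambda>t. d $ k * F (x - t *\<^sub>R u) $ k) has_derivative
        (\<lambda>t. d $ k * (J x *v (- (t *\<^sub>R u))) $ k)) (at 0)"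
      by (intro has_derivative_mult_right
          bounded_linear.has_derivative[OF bounded_linear_vec_nth])
    moreover have "(\<lambda>t. d $ k * (J x *v (- (t *\<^sub>R u))) $ k) = (*) (- (d $ k * (J x *v u) $ k))"
      by (simp add: fun_eq_iff matrix_vector_mult_scaleR flip: scaleR_minus_left)
    ultimately have "((\<lambda>t. d $ k * F (x - t *\<^sub>R u) $ k) has_real_derivative
        - (d $ k * (J x *v u) $ k)) (at 0)"
      by (simp add: has_field_derivative_def)
    from DERIV_neg_dec_right[OF this] u(3)[OF False]
    obtain e where "e > 0" "\<And>h. 0 < h \<Longrightarrow> h < e \<Longrightarrow>
        d $ k * F (x - h *\<^sub>R u) $ k < d $ k * F x $ k"
      by auto
    then show ?thesis
      unfolding eventually_at_right_field by auto
  qed simp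
  have tend: "((\<lambda>t. d $ k * (d $ k - t * u $ k)) \<longlongrightarrow> d $ k * (d $ k - 0 * u $ k)) (at_right 0)" for k
    by (intro tendsto_intros)
  \<comment> \<open>For small \<open>t\<close> no nonzero coordinate of \<open>d\<close> changes its
    sign.\<close>
  have d_k: "\<forall>\<^sub>F t in at_right 0. d $ k \<noteq> 0 \<longrightarrow> d $ k * (d $ k - t * u $ k) > 0" for k
  proof (cases "d $ k = 0")
    case False
    then have "d $ k * (d $ k - 0 * u $ k) > 0" by (auto simp: zero_less_mult_iff)
    from order_tendstoD(1)[OF tend this] show ?thesis by eventually_elim simp
  qed simp
  \<comment> \<open>Multiplied by \<open>t\<close>, this expression is the decrease of the squared
    distance to \<open>a\<close>.\<close>
  have tend': "((\<lambda>t. 2 * (d \<bullet> u) - t * (u \<bullet> u)) \<longlongrightarrow> 2 * (d \<bullet> u) - 0 * (u \<bullet> u)) (at_right 0)"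
    by (intro tendsto_intros)
  have shrink: "\<forall>\<^sub>F t in at_right 0. 2 * (d \<bullet> u) - t * (u \<bullet> u) > 0"
    using order_tendstoD(1)[OF tend', of 0] du by simp
  have "\<forall>\<^sub>F t in at_right 0. t > (0::real) \<and> 2 * (d \<bullet> u) - t * (u \<bullet> u) > 0 \<and>
      (\<forall>k. (d $ k \<noteq> 0 \<longrightarrow> d $ k * F (x - t *\<^sub>R u) $ k < d $ k * F x $ k) \<and>
           (d $ k \<noteq> 0 \<longrightarrow> d $ k * (d $ k - t * u $ k) > 0))"
    using F_k d_k shrink
    by (intro eventually_conj eventually_all_finite eventually_at_right_less) auto
  then obtain t where t: "t > 0" "2 * (d \<bullet> u) - t * (u \<bullet> u) > 0"
    "\<And>k. d $ k \<noteq> 0 \<Longrightarrow> d $ k * F (x - t *\<^sub>R u) $ k < d $ k * F x $ k"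
    "\<And>k. d $ k \<noteq> 0 \<Longrightarrow> d $ k * (d $ k - t * u $ k) > 0"
    using eventually_happens'[OF trivial_limit_at_right_real] by blast
  define z where "z = x - t *\<^sub>R u"
  have za: "z - a = d - t *\<^sub>R u" by (simp add: z_def d_def)
  \<comment> \<open>Where \<open>d\<close> vanishes, \<open>z\<close> agrees with \<open>a\<close>;
    elsewhere \<open>z - a\<close> keeps the sign of \<open>d\<close>, and
    \<open>d $ k * (F z $ k - F a $ k)\<close> has dropped below 0.\<close>
  have "z \<in> R"
    unfolding R_def
  proof (clarify)
    fix k
    have zk: "z $ k - a $ k = d $ k - t * u $ k" by (simp add: z_def d_def)
    show "(z $ k - a $ k) * (F z $ k - F a $ k) \<le> 0"
    proof (cases "d $ k = 0")
      case True
      then show ?thesis by (simp add: zk u(1))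
    next
      case False
      have "d $ k * (F x $ k - F a $ k) \<le> 0" using x by (simp add: R_def d_def)
      then have "d $ k * (F z $ k - F a $ k) < 0"
        using t(3)[OF False] by (simp add: z_def algebra_simps)
      then show ?thesis
        using t(4)[OF False] unfolding zk
        by (auto simp: zero_less_mult_iff mult_less_0_iff mult_le_0_iff)
    qed
  qed
  \<comment> \<open>Isolation of \<open>a\<close> then gives \<open>z\<close> distance at least
    \<open>\<delta>\<close>, so \<open>z\<close> competes with the minimizer
    \<open>x\<close>.\<close>
  have "z \<noteq> a"
  proof
    assume "z = a"
    then have eq: "d = t *\<^sub>R u" using za by simp
    obtain k where k: "d $ k \<noteq> 0" using d by (auto simp: vec_eq_iff)
    then show False using t(4)[OF k] eq by simp
  qed
  have "(norm (d - t *\<^sub>R u))\<^sup>2 = (norm d)\<^sup>2 - t * (2 * (d \<bullet> u) - t * (u \<bullet> u))"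
    by (simp add: power2_norm_eq_inner inner_diff_left inner_diff_right inner_commute algebra_simps)
  also have "\<dots> < (norm d)\<^sup>2" using t(1,2) by simp
  finally have less: "norm (z - a) < norm (x - a)"
    unfolding za d_def by (rule power2_less_imp_less) simp
  then have "z \<in> cball a (norm (b - a)) \<inter> (R \<inter> {x. \<delta> \<le> norm (x - a)})"
    using x \<open>z \<in> R\<close> far[OF \<open>z \<in> R\<close> \<open>z \<noteq> a\<close>] by (auto simp: dist_norm norm_minus_commute)
  from min[OF this] less show False by simp
qed

section \<open>Application to the interaction\<close>

text \<open>With the action frozen, the slice of \<open>X i \<times> UNIV\<close> is a full copy of
  the utility space, so the derivative within the product restricts to an ordinary derivative in
  \<open>u\<close>.\<close>

lemma utility_map_differentiable:
  assumes "smooth_interaction X V" and x: "x \<in> profiles X"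
  shows "utility_map V x differentiable (at u)"
proof -
  have "\<exists>D. (V i (x $ i) has_derivative D) (at u)" for i
  proof -
    have xi: "x $ i \<in> X i" using x by (simp add: profiles_def)
    obtain D where "((\<lambda>(a, u). V i a u) has_derivative D) (at (x $ i, u) within X i \<times> UNIV)"
      using assms(1) xi unfolding smooth_interaction_def C2_on_def by blast
    then have D: "((\<lambda>(a, u). V i a u) has_derivative D)
        (at (x $ i, u) within (\<lambda>v. (x $ i, v)) ` UNIV)"
      by (rule has_derivative_subset) (use xi in auto)
    have "((\<lambda>v. (x $ i, v)) has_derivative (\<lambda>v. (0, v))) (at u)"
      by (auto intro!: derivative_eq_intros)
    from has_derivative_in_compose[OF this D] show ?thesis by auto
  qed
  then obtain D where "(V i (x $ i) has_derivative D i) (at u)" for i by metis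
  then show ?thesis
    unfolding differentiable_componentwise_within[of "utility_map V x"] utility_map_def
    by (auto simp: Basis_vec_def inner_axis differentiable_def)
qed

theorem theorem2:
  fixes S X :: "'n::finite \<Rightarrow> 'a::euclidean_space set"
    and V :: "'n \<Rightarrow> 'a \<Rightarrow> real ^ 'n \<Rightarrow> real"
    and xs :: "'a ^ 'n" and us :: "real ^ 'n"
    and N :: "('a ^ 'n) set" and U :: "'a ^ 'n \<Rightarrow> real ^ 'n"
  assumes "open_in_Euclidean_spaces S X"
    and "purely_affective X V"
    and "smooth_interaction X V"
    and "\<And>x u. x \<in> profiles X \<Longrightarrow> P_matrix (mat 1 - jacobian (utility_map V x) (at u))"
    and "parametric_equilibrium X V xs us"
    and "locally_induced_game X V xs us N U"
  shows "Nash_equilibrium X N U xs"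
  unfolding Nash_equilibrium_def
proof (intro conjI allI ballI impI)
  show "xs \<in> N" using assms(6) by (simp add: locally_induced_game_def)
  fix i a assume a: "a \<in> X i" and y_N: "deviate xs i a \<in> N"
  define y where "y = deviate xs i a"
  define w where "w = U y"
  define F where "F u = u - utility_map V y u" for u
  have eqm: "utility_map V xs us = us" "\<And>z. z \<in> profiles X \<Longrightarrow> utility_map V z us \<le> us"
    using assms(5) by (auto simp: parametric_equilibrium_def consistent_def)
  have game: "U xs = us" "utility_map V y w = w"
    using assms(6) y_N by (auto simp: locally_induced_game_def y_def w_def)
  have y: "y \<in> profiles X"
    using a assms(5)
    by (auto simp: y_def deviate_def profiles_def parametric_equilibrium_def consistent_def)
  have "(F has_derivative (\<lambda>h. (mat 1 - jacobian (utility_map V y) (at u)) *v h)) (at u)" for u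
    using utility_map_differentiable[OF assms(3) y, of u]
    unfolding F_def jacobian_works matrix_vector_mult_diff_rdistrib
    by (auto intro!: derivative_eq_intros)
  from P_matrix_jacobian_imp_P_function[OF this assms(4)[OF y], of us w]
  have P: "w \<noteq> us \<Longrightarrow> \<exists>k. (w $ k - us $ k) * (F w $ k - F us $ k) > 0" by auto
  have F_w: "F w = 0" by (simp add: F_def game)
  \<comment> \<open>Individuals other than \<open>i\<close> keep their actions, so consistency of
    \<open>xs\<close> and \<open>us\<close> still holds in their components.\<close>
  have F_off: "F us $ k = 0" if "k \<noteq> i" for k
    using that arg_cong[OF eqm(1), of "\<lambda>v. v $ k"]
    by (simp add: F_def utility_map_def y_def deviate_def)
  \<comment> \<open>Here the optimality of \<open>xs\<close> at the fixed utility levels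
    \<open>us\<close> enters.\<close>
  have F_i: "F us $ i \<ge> 0"
    using eqm(2)[OF y] by (simp add: F_def less_eq_vec_def)
  have "w $ i \<le> us $ i"
  proof (rule ccontr)
    assume gt: "\<not> w $ i \<le> us $ i"
    then obtain k where k: "(w $ k - us $ k) * (F w $ k - F us $ k) > 0"
      using P by auto
    \<comment> \<open>Off \<open>i\<close> the product is 0, so the positive one is at
      \<open>i\<close>; there it equals \<open>(w $ i - us $ i) * (- F us $ i)\<close>, which cannot
      be positive.\<close>
    then have "k = i" using F_off F_w by (cases "k = i") auto
    with k gt F_i F_w show False by (simp add: zero_less_mult_iff mult_less_0_iff)
  qed
  then show "U (deviate xs i a) $ i \<le> U xs $ i"
    by (simp add: w_def y_def game)
qed

end
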